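(* Let $X$ be a Borel subspace of a separable completely metrizable space, and let $K\subseteq CD(X)$ be a compact space (in the topology of pointwise convergence). Then for every $\mu\in P(K)$ the set $$\{x\in X:\ \mu(\{g\in K:\ \operatorname{osc}(g,x)>0\})>0\}$$ is countable. Consequently, every measure $\mu\in P(K)$ is countably determined.
   Context: For a separable metrizable space $X$, $CD(X)$ denotes the space of all functions $g:X\to\mathbb R$ whose set of points of discontinuity is at most countable, equipped with the topology of pointwise convergence, i.e. as a subspace of the product $\mathbb R^X$. For $g:X\to\mathbb R$ and $x\in X$, $\operatorname{osc}(g,x)$ is the oscillation of $g$ at $x$, i.e. the infimum of $\operatorname{diam}(g[U])$ over open neighbourhoods $U$ of $x$ in $X$. For a compact space $K$, $P(K)$ is the set of Radon probability measures on $K$. A measure $\mu\in P(K)$ is countably determined if there is a countable family $\mathcal F$ of closed subsets of $K$ such that $\mu(U)=\sup\{\mu(F): F\subseteq U,\ F\in\mathcal F\}$ for every open $U\subseteq K$. *)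

theory Defs
  imports "HOL-Probability.Probability"
begin

text \<open>
  A function \<open>X \<rightarrow> \<real>\<close> is represented by the element of \<^term>\<open>X \<rightarrow>\<^sub>E (UNIV :: real set)\<close>, as in
  \<^const>\<open>product_topology\<close>: it takes the value \<^const>\<open>undefined\<close> off \<open>X\<close>.  Continuity is always
  relative to \<open>X\<close>.
\<close>

definition CD :: "'a::metric_space set \<Rightarrow> ('a \<Rightarrow> real) set" where
  "CD X = {g \<in> X \<rightarrow>\<^sub>E UNIV. countable {x \<in> X. \<not> continuous (at x within X) g}}"

definition CD_topology :: "'a::metric_space set \<Rightarrow> ('a \<Rightarrow> real) topology" where
  "CD_topology X = subtopology (product_topology (\<lambda>_. euclideanreal) X) (CD X)"

text \<open>
  Diameters take values in \<^typ>\<open>ennreal\<close>, because \<^const>\<open>diameter\<close> has no meaningful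
  value on unbounded sets.
\<close>

definition ediameter :: "'b::metric_space set \<Rightarrow> ennreal" where
  "ediameter S = (SUP (a, b) \<in> S \<times> S. ennreal (dist a b))"

definition osc :: "'a::metric_space set \<Rightarrow> ('a \<Rightarrow> real) \<Rightarrow> 'a \<Rightarrow> ennreal" where
  "osc X g x = (INF U \<in> {U. openin (top_of_set X) U \<and> x \<in> U}. ediameter (g ` U))"

definition borel_of :: "'b topology \<Rightarrow> 'b measure" where
  "borel_of T = sigma (topspace T) {U. openin T U}"

text \<open>
  The Radon probability measures, taken on the Borel \<open>\<sigma>\<close>-algebra (not completed).
  The definition is meant for Hausdorff \<open>T\<close>, where compact sets are Borel.
\<close>

definition radon_prob_measures :: "'b topology \<Rightarrow> 'b measure set" where
  "radon_prob_measures T = {\<mu>. prob_space \<mu> \<and> sets \<mu> = sets (borel_of T) \<and>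
     (\<forall>B \<in> sets \<mu>. emeasure \<mu> B = (SUP C \<in> {C. compactin T C \<and> C \<subseteq> B}. emeasure \<mu> C))}"

definition countably_determined :: "'b topology \<Rightarrow> 'b measure \<Rightarrow> bool" where
  "countably_determined T \<mu> \<longleftrightarrow>
     (\<exists>\<F>. countable \<F> \<and> (\<forall>F \<in> \<F>. closedin T F) \<and>
        (\<forall>U. openin T U \<longrightarrow> emeasure \<mu> U = (SUP F \<in> {F \<in> \<F>. F \<subseteq> U}. emeasure \<mu> F)))"

text \<open>
  The sets \<open>{g \<in> K. osc X g x > 0}\<close> are Borel, so \<^const>\<open>emeasure\<close> does not return its
  default value \<open>0\<close> on them.
\<close>

lemma sets_borel_of_osc_pos:
  fixes X :: "'a::{metric_space, second_countable_topology} set"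
  assumes K: "K \<subseteq> CD X" and x: "x \<in> X"
  shows "{g \<in> K. osc X g x > 0} \<in> sets (borel_of (subtopology (CD_topology X) K))"
proof -
  let ?T = "subtopology (CD_topology X) K"
  have top: "topspace ?T = K"
    using K by (auto simp: CD_topology_def CD_def)
  have ev: "continuous_map ?T euclideanreal (\<lambda>g. g a)" if "a \<in> X" for a
    unfolding CD_topology_def
    by (intro continuous_map_from_subtopology continuous_map_product_projection that)
  have "{U. openin ?T U} \<subseteq> Pow (topspace ?T)"
    using openin_subset by blast
  then have setsI: "U \<in> sets (borel_of ?T)" if "openin ?T U" for U
    unfolding borel_of_def using that by (simp add: sigma_sets.Basic)
  have gt: "{g \<in> K. ediameter (g ` V) > c} \<in> sets (borel_of ?T)" if "V \<subseteq> X" for V c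
  proof -
    have "openin ?T {g \<in> K. ennreal (dist (g a) (g b)) > c}" if "a \<in> X" "b \<in> X" for a b
    proof -
      have "continuous_map ?T euclidean (\<lambda>g. ennreal (dist (g a) (g b)))"
      proof -
        have "continuous_map ?T euclideanreal (\<lambda>g. \<bar>g a - g b\<bar>)"
          by (intro continuous_intros ev that)
        moreover have "continuous_map euclideanreal euclidean ennreal"
          by (simp add: continuous_on_ennreal)
        ultimately show ?thesis
          using continuous_map_compose[of ?T euclideanreal "\<lambda>g. \<bar>g a - g b\<bar>" euclidean ennreal]
          by (simp add: dist_real_def o_def)
      qed
      then have "openin ?T {g \<in> topspace ?T. ennreal (dist (g a) (g b)) \<in> {c<..}}"
        by (rule openin_continuous_map_preimage) auto
      then show ?thesis unfolding top by simp
    qed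
    then have "openin ?T (\<Union>a\<in>V. \<Union>b\<in>V. {g \<in> K. ennreal (dist (g a) (g b)) > c})"
      using that by (intro openin_Union) blast
    also have "(\<Union>a\<in>V. \<Union>b\<in>V. {g \<in> K. ennreal (dist (g a) (g b)) > c})
      = {g \<in> K. ediameter (g ` V) > c}"
      by (auto simp: ediameter_def less_SUP_iff)
    finally show ?thesis by (rule setsI)
  qed
  obtain \<B> :: "'a set set" where B: "countable \<B>" "topological_basis \<B>"
    using ex_countable_basis by blast
  have eq: "{g \<in> K. osc X g x > 0} =
    (\<Union>n. \<Inter>V\<in>{V\<in>\<B>. x \<in> V}. {g \<in> K. ediameter (g ` (X \<inter> V)) > ennreal (1 / Suc n)})"
    (is "?L = ?R")
  proof (intro subset_antisym subsetI)
    fix g assume g: "g \<in> ?L"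
    obtain q :: real where q: "0 < ennreal q" "ennreal q < osc X g x"
    proof -
      obtain p where p: "0 < p" "p < osc X g x" using g dense by blast
      then have "p \<noteq> top" by auto
      with p that show ?thesis by (cases p) auto
    qed
    then have "q > 0" by simp
    then obtain n where n: "1 / real (Suc n) < q"
      using nat_approx_posE by (metis of_nat_Suc)
    have "ediameter (g ` (X \<inter> V)) > ennreal (1 / Suc n)" if "V \<in> \<B>" "x \<in> V" for V
    proof -
      have "openin (top_of_set X) (X \<inter> V)"
        using B(2) that by (simp add: openin_open_Int topological_basis_open)
      then have "osc X g x \<le> ediameter (g ` (X \<inter> V))"
        unfolding osc_def using that x by (intro INF_lower) auto
      moreover have "ennreal (1 / Suc n) \<le> ennreal q"
        using n by (intro ennreal_leI) simp
      ultimately show ?thesis using q(2) by (meson le_less_trans less_le_trans)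
    qed
    moreover have "\<exists>V\<in>\<B>. x \<in> V"
      using topological_basisE[OF B(2) open_UNIV, of x] by auto
    ultimately show "g \<in> ?R" using g by blast
  next
    fix g assume g: "g \<in> ?R"
    obtain V0 where V0: "V0 \<in> \<B>" "x \<in> V0"
      using topological_basisE[OF B(2) open_UNIV, of x] by auto
    obtain n where n: "\<And>V. V \<in> \<B> \<Longrightarrow> x \<in> V \<Longrightarrow> g \<in> K \<and> ediameter (g ` (X \<inter> V)) > ennreal (1 / Suc n)"
      using g by blast
    have "ennreal (1 / Suc n) \<le> osc X g x"
      unfolding osc_def
    proof (rule INF_greatest)
      fix U assume "U \<in> {U. openin (top_of_set X) U \<and> x \<in> U}"
      then obtain W where W: "open W" "U = X \<inter> W" "x \<in> W"
        by (auto simp: openin_open)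
      then obtain V where V: "V \<in> \<B>" "x \<in> V" "V \<subseteq> W"
        using topological_basisE[OF B(2), of W x] by metis
      have "ediameter (g ` (X \<inter> V)) \<le> ediameter (g ` U)"
        unfolding ediameter_def using V W by (intro SUP_subset_mono) auto
      then show "ennreal (1 / Suc n) \<le> ediameter (g ` U)"
        using n[OF V(1,2)] by (meson less_imp_le order_trans)
    qed
    moreover have "0 < ennreal (1 / Suc n)" by simp
    ultimately have "osc X g x > 0" by (rule less_le_trans[rotated])
    then show "g \<in> ?L" using n[OF V0] by simp
  qed
  obtain V0 where V0: "V0 \<in> \<B>" "x \<in> V0"
    using topological_basisE[OF B(2) open_UNIV, of x] by auto
  have "countable {V\<in>\<B>. x \<in> V}" using B(1) by (rule countable_subset[rotated]) auto
  then have "(\<Inter>V\<in>{V\<in>\<B>. x \<in> V}. {g \<in> K. ediameter (g ` (X \<inter> V)) > ennreal (1 / Suc n)})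
      \<in> sets (borel_of ?T)" for n
    using V0 by (intro sets.countable_INT') (auto intro!: gt)
  then show ?thesis unfolding eq by blast
qed

end

theory Submission
  imports Defs
begin

text \<open>
  The set \<open>W = {(g, x). osc X g x > 0}\<close> is built from countably many rectangles, so it is
  measurable in \<open>K \<times> X\<close>, and \<open>E = {x. \<mu> {g. (g, x) \<in> W} > 0}\<close> is a Borel set.  If \<open>E\<close> were
  uncountable, it would carry an atomless Borel probability \<open>\<nu>\<close>.  Every \<open>g \<in> K\<close> has only countably
  many discontinuities, so \<open>(\<mu> \<otimes> \<nu>) W = 0\<close>, and Fubini contradicts the definition of \<open>E\<close>.

  For the second part, if \<open>x \<notin> E\<close>, then \<open>\<mu>\<close>-almost every \<open>g\<close> is continuous at \<open>x\<close>; so \<open>g x\<close> lies in an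
  open interval only if \<open>g\<close> maps a basic neighbourhood of \<open>x\<close> into some \<open>[p, q]\<close> inside it, with
  \<open>p\<close> and \<open>q\<close> rational.  The sets \<open>{g \<in> K. g ` Y \<subseteq> {p..q}}\<close>, with \<open>Y\<close> a basic open subset of \<open>X\<close> or a
  singleton from \<open>E\<close>, are closed and countable in number, and their finite unions of finite
  intersections determine \<open>\<mu>\<close>.
\<close>

section \<open>Atomless measures on uncountable Borel sets\<close>

text \<open>The type \<^typ>\<open>nat discrete\<close> stands for \<^typ>\<open>nat\<close>, which is not an instance of the
  class of metric spaces; the second factor is thus the Baire space.\<close>

definition souslin :: "'a::topological_space set \<Rightarrow> bool" where
  "souslin B \<longleftrightarrow> (\<exists>C :: ('a \<times> (nat \<Rightarrow> nat discrete)) set. closed C \<and> fst ` C = B)"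

lemma souslin_closed:
  assumes "closed B" shows "souslin B"
  unfolding souslin_def
  by (rule exI[of _ "B \<times> UNIV"]) (use assms in \<open>auto intro: closed_Times\<close>)

text \<open>Entry 0 of the sequence names an index n, and the remaining entries are a witness for
  membership in \<open>B n\<close>.\<close>

lemma souslin_UN:
  fixes B :: "nat \<Rightarrow> 'a::topological_space set"
  assumes "\<And>n. souslin (B n)" shows "souslin (\<Union>n. B n)"
proof -
  obtain C :: "nat \<Rightarrow> ('a \<times> (nat \<Rightarrow> nat discrete)) set"
    where C: "\<And>n. closed (C n)" "\<And>n. fst ` C n = B n"
    using assms unfolding souslin_def by metis
  \<comment> \<open>The choice of the index is written as an intersection of implications, one for
    each n, which makes \<open>D\<close> closed: singletons of the discrete factor are open, so the
    first alternative is closed.\<close>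
  define D where "D = (\<Inter>n. {z. snd z 0 \<noteq> discrete n} \<union> (\<lambda>z. (fst z, \<lambda>k. snd z (Suc k))) -` C n)"
  have c: "continuous_on UNIV (\<lambda>z::'a \<times> (nat \<Rightarrow> nat discrete). snd z k)" for k
    using continuous_on_compose2[OF continuous_on_product_coordinates continuous_on_snd[OF continuous_on_id]]
    by auto
  have "closed {z::'a \<times> (nat \<Rightarrow> nat discrete). snd z 0 \<noteq> discrete n}" for n
  proof -
    have "closed ((\<lambda>z::'a \<times> (nat \<Rightarrow> nat discrete). snd z 0) -` (- {discrete n}))"
      by (intro closed_vimage c) (simp add: closed_def open_discrete)
    then show ?thesis by (simp add: vimage_def)
  qed
  moreover have "closed ((\<lambda>z. (fst z, \<lambda>k. snd z (Suc k))) -` C n)" for n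
    by (intro closed_vimage C continuous_on_Pair continuous_on_coordinatewise_then_product c continuous_intros)
  ultimately have "closed D" unfolding D_def by blast
  moreover have "fst ` D = (\<Union>n. B n)"
  proof (intro subset_antisym subsetI)
    fix x assume "x \<in> fst ` D"
    then obtain w where "(x, w) \<in> D" by auto
    then have "(x, \<lambda>k. w (Suc k)) \<in> C (of_discrete (w 0))"
      by (auto simp: D_def of_discrete_inverse)
    then show "x \<in> (\<Union>n. B n)" using C(2) by (metis UN_I UNIV_I fst_conv imageI)
  next
    fix x assume "x \<in> (\<Union>n. B n)"
    then obtain n w where "(x, w) \<in> C n" using C(2) by fastforce
    then have "(x, case_nat (discrete n) w) \<in> D" by (auto simp: D_def discrete_inject)
    then show "x \<in> fst ` D" by force
  qed
  ultimately show ?thesis unfolding souslin_def by blast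
qed

text \<open>One sequence carries countably many witnesses at once: the entries at
  \<open>prod_encode (n, k)\<close>, for varying k, form the n-th one.\<close>

lemma souslin_INT:
  fixes B :: "nat \<Rightarrow> 'a::topological_space set"
  assumes "\<And>n. souslin (B n)" shows "souslin (\<Inter>n. B n)"
proof -
  obtain C :: "nat \<Rightarrow> ('a \<times> (nat \<Rightarrow> nat discrete)) set"
    where C: "\<And>n. closed (C n)" "\<And>n. fst ` C n = B n"
    using assms unfolding souslin_def by metis
  define D where "D = (\<Inter>n. (\<lambda>z. (fst z, \<lambda>k. snd z (prod_encode (n, k)))) -` C n)"
  have c: "continuous_on UNIV (\<lambda>z::'a \<times> (nat \<Rightarrow> nat discrete). snd z k)" for k
    using continuous_on_compose2[OF continuous_on_product_coordinates continuous_on_snd[OF continuous_on_id]]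
    by auto
  have "closed ((\<lambda>z. (fst z, \<lambda>k. snd z (prod_encode (n, k)))) -` C n)" for n
    by (intro closed_vimage C continuous_on_Pair continuous_on_coordinatewise_then_product c continuous_intros)
  then have "closed D" unfolding D_def by blast
  moreover have "fst ` D = (\<Inter>n. B n)"
  proof (intro subset_antisym subsetI)
    fix x assume "x \<in> fst ` D"
    then obtain w where "(x, w) \<in> D" by auto
    then have "(x, \<lambda>k. w (prod_encode (n, k))) \<in> C n" for n by (auto simp: D_def)
    then show "x \<in> (\<Inter>n. B n)" using C(2) by (metis INT_I fst_conv imageI)
  next
    fix x assume "x \<in> (\<Inter>n. B n)"
    then have "\<exists>w. (x, w) \<in> C n" for n using C(2)[of n] by fastforce
    then obtain w where "\<And>n. (x, w n) \<in> C n" by metis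
    then have "(x, \<lambda>i. w (fst (prod_decode i)) (snd (prod_decode i))) \<in> D"
      by (auto simp: D_def)
    then show "x \<in> fst ` D" by force
  qed
  ultimately show ?thesis unfolding souslin_def by blast
qed

lemma souslin_open:
  fixes U :: "'a::metric_space set"
  assumes "open U" shows "souslin U"
proof -
  have "fsigma_in euclidean U"
    using assms open_imp_fsigma_in[of euclidean U] metrizable_space_euclidean
    by (metis open_openin)
  then obtain F :: "nat \<Rightarrow> 'a set" where F: "\<And>n. closed (F n)" "(\<Union>n. F n) = U"
    unfolding fsigma_in_ascending by auto
  then show ?thesis using souslin_UN[of F] souslin_closed by auto
qed

text \<open>Souslin sets are not closed under complements, hence the induction on pairs.\<close>

lemma souslin_borel:
  fixes B :: "'a::metric_space set"
  assumes "B \<in> sets borel" shows "souslin B"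
proof -
  have "B \<in> sigma_sets UNIV {S. open S}" using assms by (simp add: sets_borel)
  then have "souslin B \<and> souslin (- B)"
  proof induction
    case (Basic U) then show ?case by (auto intro: souslin_open souslin_closed)
  next
    case (Union F)
    then show ?case by (auto simp: Compl_UN intro: souslin_UN souslin_INT)
  qed (auto simp: Compl_eq_Diff_UNIV[symmetric] intro: souslin_closed)
  then show ?thesis ..
qed

section \<open>Condensation points and Cantor schemes\<close>

text \<open>A Lindeloef argument: each such point lies in a basic set meeting \<open>D\<close> in a
  countable set, and there are only countably many basic sets.\<close>

lemma condensation_points:
  fixes D :: "'a::second_countable_topology set"
  shows "countable {x \<in> D. \<exists>U. open U \<and> x \<in> U \<and> countable (D \<inter> U)}"
proof -
  obtain \<B> :: "'a set set" where B: "countable \<B>" "topological_basis \<B>"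
    using ex_countable_basis by blast
  have "{x \<in> D. \<exists>U. open U \<and> x \<in> U \<and> countable (D \<inter> U)} \<subseteq> (\<Union>V\<in>{V\<in>\<B>. countable (D \<inter> V)}. D \<inter> V)"
  proof
    fix x assume "x \<in> {x \<in> D. \<exists>U. open U \<and> x \<in> U \<and> countable (D \<inter> U)}"
    then obtain U where U: "x \<in> D" "open U" "x \<in> U" "countable (D \<inter> U)" by blast
    then obtain V where V: "V \<in> \<B>" "x \<in> V" "V \<subseteq> U" using topological_basisE[OF B(2)] by metis
    then have "countable (D \<inter> V)" using U(4) by (meson Int_mono countable_subset order_refl)
    then show "x \<in> (\<Union>V\<in>{V\<in>\<B>. countable (D \<inter> V)}. D \<inter> V)" using U V by blast
  qed
  moreover have "countable (\<Union>V\<in>{V\<in>\<B>. countable (D \<inter> V)}. D \<inter> V)"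
    using B(1) by (intro countable_UN countable_subset[OF _ B(1)]) auto
  ultimately show ?thesis by (rule countable_subset)
qed

text \<open>\<open>D\<close> consists of the condensation points of a subset of \<open>C\<close> on which \<open>f\<close> is injective.\<close>

lemma uncountable_split:
  fixes f :: "'z::{metric_space, second_countable_topology} \<Rightarrow> 'a::metric_space"
  assumes f: "continuous_on C f" and unc: "uncountable (f ` C)"
  obtains D where "D \<noteq> {}" "D \<subseteq> C"
    "\<And>x r. x \<in> D \<Longrightarrow> 0 < r \<Longrightarrow> \<exists>x0\<in>D. \<exists>x1\<in>D. \<exists>e>0. e \<le> r / 2 \<and> cball x0 e \<subseteq> cball x r \<and>
       cball x1 e \<subseteq> cball x r \<and> f ` (C \<inter> cball x0 e) \<inter> f ` (C \<inter> cball x1 e) = {}"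
proof -
  \<comment> \<open>One preimage is chosen for each value, so \<open>D0\<close> inherits
    uncountability from the image.\<close>
  define D0 where "D0 = inv_into C f ` f ` C"
  have D0: "D0 \<subseteq> C" "inj_on f D0"
    unfolding D0_def by (auto intro: inv_into_into simp: inj_on_def f_inv_into_f)
  have unc0: "uncountable D0"
    unfolding D0_def using unc by (metis countable_image_inj_on inj_on_inv_into order_refl)
  let ?N = "{x \<in> D0. \<exists>U. open U \<and> x \<in> U \<and> countable (D0 \<inter> U)}"
  define D where "D = D0 - ?N"
  have N: "countable ?N" by (rule condensation_points)
  \<comment> \<open>Only countably many points were removed from \<open>D0\<close>, so points of
    \<open>D\<close> condense in \<open>D\<close> itself; the splitting can therefore be repeated at
    the new centres.\<close>
  have D: "uncountable (D \<inter> U)" if "x \<in> D" "open U" "x \<in> U" for x U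
  proof
    assume "countable (D \<inter> U)"
    then have "countable ((D \<inter> U) \<union> ?N)" using N by blast
    moreover have "D0 \<inter> U \<subseteq> (D \<inter> U) \<union> ?N" by (auto simp: D_def)
    ultimately have "countable (D0 \<inter> U)" by (rule countable_subset[rotated])
    then show False using that by (auto simp: D_def)
  qed
  show ?thesis
  proof
    show "D \<noteq> {}" 
    proof
      assume "D = {}"
      then have "D0 \<subseteq> ?N" by (auto simp: D_def)
      then show False using N unc0 countable_subset by blast
    qed
    show "D \<subseteq> C" using D0 by (auto simp: D_def)
    fix x and r :: real assume x: "x \<in> D" and r: "0 < r"
    have "uncountable (D \<inter> ball x r)" using D[OF x, of "ball x r"] r by simp
    then have "infinite (D \<inter> ball x r)" using countable_finite by blast
    then obtain x0 where x0: "x0 \<in> D \<inter> ball x r" using infinite_imp_nonempty by blast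
    have "infinite (D \<inter> ball x r - {x0})" using \<open>infinite (D \<inter> ball x r)\<close> by simp
    then obtain x1 where x1: "x1 \<in> D \<inter> ball x r - {x0}" using infinite_imp_nonempty by blast
    have ne: "f x0 \<noteq> f x1" using x0 x1 D0 by (auto simp: D_def inj_on_def)
    \<comment> \<open>Half the distance of the two values: balls whose images stay within
      \<open>d\<close> of \<open>f x0\<close> and of \<open>f x1\<close> have disjoint
      images.\<close>
    define d where "d = dist (f x0) (f x1) / 2"
    have "d > 0" using ne by (simp add: d_def)
    have ev: "\<exists>a>0. \<forall>e<a. cball y e \<subseteq> cball x r \<and> (\<forall>z\<in>C \<inter> cball y e. dist (f z) (f y) < d)"
      if y: "y \<in> D \<inter> ball x r" for y
    proof -
      obtain a where a: "a > 0" "\<And>z. z \<in> C \<Longrightarrow> dist z y < a \<Longrightarrow> dist (f z) (f y) < d"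
        using f \<open>d > 0\<close> y \<open>D \<subseteq> C\<close> unfolding continuous_on_iff by blast
      have "cball y e \<subseteq> cball x r" if "e < r - dist x y" for e
      proof
        fix z assume "z \<in> cball y e"
        then show "z \<in> cball x r" using that dist_triangle[of x z y] by simp
      qed
      moreover have "dist (f z) (f y) < d" if "e < a" "z \<in> C \<inter> cball y e" for e z
        using a(2)[of z] that by (simp add: dist_commute)
      ultimately show ?thesis
        using a(1) y by (intro exI[of _ "min a (r - dist x y)"]) auto
    qed
    obtain a0 where a0: "a0 > 0"
        "\<And>e. e < a0 \<Longrightarrow> cball x0 e \<subseteq> cball x r \<and> (\<forall>z\<in>C \<inter> cball x0 e. dist (f z) (f x0) < d)"
      using ev[OF x0] by blast
    obtain a1 where a1: "a1 > 0"
        "\<And>e. e < a1 \<Longrightarrow> cball x1 e \<subseteq> cball x r \<and> (\<forall>z\<in>C \<inter> cball x1 e. dist (f z) (f x1) < d)"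
      using ev[of x1] x1 by blast
    define e where "e = min r (min a0 a1) / 2"
    have e: "0 < e" "e \<le> r / 2" "e < a0" "e < a1"
      using r a0(1) a1(1) by (auto simp: e_def min_def)
    have "f ` (C \<inter> cball x0 e) \<inter> f ` (C \<inter> cball x1 e) = {}"
    proof (rule ccontr)
      assume "\<not> ?thesis"
      then obtain y where "y \<in> f ` (C \<inter> cball x0 e)" "y \<in> f ` (C \<inter> cball x1 e)" by blast
      then have "dist y (f x0) < d" "dist y (f x1) < d"
        using a0(2)[OF e(3)] a1(2)[OF e(4)] by auto
      then show False using dist_triangle3[of "f x0" "f x1" y] by (simp add: d_def)
    qed
    then show "\<exists>x0\<in>D. \<exists>x1\<in>D. \<exists>e>0. e \<le> r / 2 \<and> cball x0 e \<subseteq> cball x r \<and>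
       cball x1 e \<subseteq> cball x r \<and> f ` (C \<inter> cball x0 e) \<inter> f ` (C \<inter> cball x1 e) = {}"
      using e(1,2) a0(2)[OF e(3)] a1(2)[OF e(4)] x0 x1
      by (intro bexI[of _ x0] bexI[of _ x1] exI[of _ e]) auto
  qed
qed

text \<open>A binary tree of closed balls with centres in \<open>C\<close>, the radii at least
  halving at each step. By completeness each branch converges to a point of \<open>C\<close>; the
  images of sibling balls are disjoint, so different branches yield different values of
  \<open>f\<close>.\<close>

lemma cantor_scheme:
  fixes f :: "'z::{complete_space, second_countable_topology} \<Rightarrow> 'a::metric_space"
  assumes C: "closed C" and f: "continuous_on C f" and unc: "uncountable (f ` C)"
  obtains h :: "(nat \<Rightarrow> bool) \<Rightarrow> 'a"
  where "h \<in> borel_measurable (PiM UNIV (\<lambda>_. count_space UNIV))" "inj h" "range h \<subseteq> f ` C"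
proof -
  obtain D where D: "D \<noteq> {}" "D \<subseteq> C"
    "\<And>x r. x \<in> D \<Longrightarrow> 0 < r \<Longrightarrow> \<exists>x0\<in>D. \<exists>x1\<in>D. \<exists>e>0. e \<le> r / 2 \<and> cball x0 e \<subseteq> cball x r \<and>
       cball x1 e \<subseteq> cball x r \<and> f ` (C \<inter> cball x0 e) \<inter> f ` (C \<inter> cball x1 e) = {}"
    using uncountable_split[OF f unc] by metis
  define ok where "ok s \<longleftrightarrow> fst s \<in> D \<and> 0 < snd s" for s :: "'z \<times> real"
  define cb where "cb s = cball (fst s) (snd s)" for s :: "'z \<times> real"
  have "\<exists>G. ok s \<longrightarrow> (\<forall>b. ok (G b) \<and> snd (G b) \<le> snd s / 2 \<and> cb (G b) \<subseteq> cb s) \<and>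
      f ` (C \<inter> cb (G True)) \<inter> f ` (C \<inter> cb (G False)) = {}" for s
  proof (cases "ok s")
    case True
    then obtain x0 x1 e where "x0 \<in> D" "x1 \<in> D" "e > 0" "e \<le> snd s / 2"
      "cball x0 e \<subseteq> cb s" "cball x1 e \<subseteq> cb s" "f ` (C \<inter> cball x0 e) \<inter> f ` (C \<inter> cball x1 e) = {}"
      using D(3)[of "fst s" "snd s"] unfolding ok_def cb_def by blast
    then show ?thesis
      by (intro exI[of _ "\<lambda>b. (if b then x0 else x1, e)"]) (auto simp: ok_def cb_def)
  qed simp
  then obtain G where G: "\<And>s b. ok s \<Longrightarrow> ok (G s b)" "\<And>s b. ok s \<Longrightarrow> snd (G s b) \<le> snd s / 2"
      "\<And>s b. ok s \<Longrightarrow> cb (G s b) \<subseteq> cb s"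
      "\<And>s. ok s \<Longrightarrow> f ` (C \<inter> cb (G s True)) \<inter> f ` (C \<inter> cb (G s False)) = {}"
    by metis
  obtain x where "x \<in> D" using D(1) by blast
  \<comment> \<open>The node reached after n steps along the branch \<open>b\<close>; it depends
    only on the first n bits.\<close>
  define c where "c b = rec_nat (x, 1) (\<lambda>n s. G s (b n))" for b :: "nat \<Rightarrow> bool"
  have c_simps: "c b 0 = (x, 1)" "c b (Suc n) = G (c b n) (b n)" for b n
    by (simp_all add: c_def)
  have ok: "ok (c b n)" for b n
    by (induction n) (use \<open>x \<in> D\<close> in \<open>auto simp: c_simps G, simp add: ok_def\<close>)
  have rad: "snd (c b n) \<le> (1 / 2) ^ n" for b n
  proof (induction n)
    case (Suc n)
    then show ?case using G(2)[OF ok, of b n "b n"] by (simp add: c_simps)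
  qed (simp add: c_simps)
  have nest: "cb (c b m) \<subseteq> cb (c b n)" if "n \<le> m" for b m n
    using lift_Suc_antimono_le[OF _ that, of "\<lambda>n. cb (c b n)"] G(3)[OF ok] by (simp add: c_simps)
  have inC: "fst (c b n) \<in> C" for b n using ok D(2) by (auto simp: ok_def)
  have mem: "fst (c b m) \<in> cb (c b n)" if "n \<le> m" for b m n
  proof -
    have "fst (c b m) \<in> cb (c b m)" using ok[of b m] by (auto simp: cb_def ok_def)
    then show ?thesis using nest[OF that] by blast
  qed
  have "Cauchy (\<lambda>n. fst (c b n))" for b
  proof (rule metric_CauchyI)
    fix e :: real assume "0 < e"
    then obtain N where N: "(1 / 2) ^ N < e / 2"
      using real_arch_pow_inv[of "e / 2" "1 / 2"] by auto
    have "dist (fst (c b N)) (fst (c b m)) < e / 2" if "N \<le> m" for m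
      using mem[OF that, of b] rad[of b N] N by (simp add: cb_def)
    then show "\<exists>M. \<forall>m\<ge>M. \<forall>n\<ge>M. dist (fst (c b m)) (fst (c b n)) < e"
      by (metis dist_commute dist_triangle_half_l)
  qed
  then have "\<exists>z. (\<lambda>n. fst (c b n)) \<longlonglongrightarrow> z" for b
    using Cauchy_convergent convergent_def by blast
  then obtain z where z: "\<And>b. (\<lambda>n. fst (c b n)) \<longlonglongrightarrow> z b" by metis
  have zC: "z b \<in> C" for b
    by (rule closed_sequentially[OF C inC z])
  have zcb: "z b \<in> cb (c b n)" for b n
  proof (rule Lim_in_closed_set[OF _ _ _ z])
    show "closed (cb (c b n))" by (simp add: cb_def)
    show "\<forall>\<^sub>F m in sequentially. fst (c b m) \<in> cb (c b n)"
      by (rule eventually_sequentiallyI[of n]) (rule mem)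
  qed simp
  let ?M = "PiM UNIV (\<lambda>_. count_space UNIV) :: (nat \<Rightarrow> bool) measure"
  have sp: "space ?M = UNIV" by (simp add: space_PiM)
  \<comment> \<open>\<open>P\<close> is arbitrary: only finitely many bits enter, and splitting on
    the last one gives a finite union of measurable sets.\<close>
  have c_meas: "{b. P (c b n)} \<in> sets ?M" for P n
  proof (induction n arbitrary: P)
    case 0
    then show ?case using sets.top[of ?M] by (cases "P (x, 1)") (auto simp: c_simps sp)
  next
    case (Suc n)
    have *: "{b. b n = t} \<in> sets ?M" for t
    proof -
      have "(\<lambda>b. b n) -` {t} \<inter> space ?M \<in> sets ?M"
        by (rule measurable_sets[OF measurable_component_singleton]) auto
      then show ?thesis by (simp add: sp vimage_def)
    qed
    have "{b. P (c b (Suc n))} = (\<Union>t. {b. b n = t} \<inter> {b. P (G (c b n) t)})"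
      by (auto simp: c_simps)
    also have "\<dots> \<in> sets ?M"
      by (intro sets.finite_UN sets.Int * Suc) auto
    finally show ?case .
  qed
  \<comment> \<open>Continuity of \<open>f\<close> is given only on \<open>C\<close>, so
    measurability is obtained from a pointwise limit of the functions of finitely many bits treated
    above.\<close>
  have "(\<lambda>b. f (z b)) \<in> borel_measurable ?M"
  proof (rule borel_measurable_LIMSEQ_metric)
    show "(\<lambda>b. f (fst (c b n))) \<in> borel_measurable ?M" for n
      using c_meas[of "\<lambda>s. f (fst s) \<in> _" n] by (intro measurableI) (auto simp: sp vimage_def)
    show "(\<lambda>n. f (fst (c b n))) \<longlonglongrightarrow> f (z b)" for b
      using f zC inC z unfolding continuous_on_sequentially comp_def by meson
  qed
  moreover have "inj (\<lambda>b. f (z b))"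
  proof (rule injI, rule ccontr)
    fix a b assume eq: "f (z a) = f (z b)" and "a \<noteq> b"
    \<comment> \<open>At the first differing bit the two branches leave a common node into sibling
      balls.\<close>
    define n where "n = (LEAST n. a n \<noteq> b n)"
    obtain k where "a k \<noteq> b k" using \<open>a \<noteq> b\<close> by blast
    then have n: "a n \<noteq> b n" unfolding n_def by (rule LeastI[of "\<lambda>n. a n \<noteq> b n"])
    have "c a m = c b m" if "m \<le> n" for m
      using that
    proof (induction m)
      case (Suc m)
      then have "a m = b m" using not_less_Least[of m "\<lambda>n. a n \<noteq> b n"] by (auto simp: n_def)
      with Suc show ?case by (simp add: c_simps)
    qed (simp add: c_simps)
    then have "c a (Suc n) = G (c a n) (a n)" "c b (Suc n) = G (c a n) (\<not> a n)"
      using n by (auto simp: c_simps)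
    then have "z a \<in> C \<inter> cb (G (c a n) (a n))" "z b \<in> C \<inter> cb (G (c a n) (\<not> a n))"
      using zcb[of a "Suc n"] zcb[of b "Suc n"] zC by auto
    then have "f (z a) \<in> f ` (C \<inter> cb (G (c a n) (a n))) \<inter> f ` (C \<inter> cb (G (c a n) (\<not> a n)))"
      using eq by blast
    moreover have "f ` (C \<inter> cb (G (c a n) t)) \<inter> f ` (C \<inter> cb (G (c a n) (\<not> t))) = {}" for t
      using G(4)[OF ok, of a n] by (cases t) (simp_all add: Int_commute)
    ultimately show False by simp
  qed
  ultimately show ?thesis using zC by (intro that) auto
qed

section \<open>Fair coin tossing and its push-forward\<close>

text \<open>The point lies in the cylinder that fixes its first n bits, and this has measure
  \<open>(1/2) ^ n\<close>.\<close>

lemma coin_space_atomless: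
  fixes b :: "nat \<Rightarrow> bool"
  shows "emeasure (PiM UNIV (\<lambda>_. measure_pmf (bernoulli_pmf (1/2)))) {b} = 0" (is "emeasure ?M _ = 0")
proof -
  interpret product_prob_space "\<lambda>_. measure_pmf (bernoulli_pmf (1/2))" "UNIV :: nat set"
    by unfold_locales
  have "emeasure ?M {b} \<le> ennreal ((1/2) ^ n)" for n
  proof -
    have "emeasure ?M {b} \<le> emeasure ?M {x \<in> space ?M. \<forall>i\<in>{..<n}. x i \<in> {b i}}"
    proof (rule emeasure_mono)
      have "(\<lambda>x. x i) -` {b i} \<inter> space ?M \<in> sets ?M" for i
        by (rule measurable_sets[OF measurable_component_singleton]) auto
      then show "{x \<in> space ?M. \<forall>i\<in>{..<n}. x i \<in> {b i}} \<in> sets ?M"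
        by (intro sets.sets_Collect_finite_All) (auto simp: vimage_def Int_def conj_commute)
    qed (auto simp: space_PiM)
    also have "\<dots> = (\<Prod>i<n. emeasure (measure_pmf (bernoulli_pmf (1/2))) {b i})"
      by (rule emeasure_PiM_Collect) auto
    also have "\<dots> = (\<Prod>i<n. ennreal (1/2))"
      by (intro prod.cong refl) (case_tac "b x"; simp add: emeasure_pmf_single)
    also have "\<dots> = ennreal ((1/2) ^ n)"
      by (subst ennreal_power[symmetric]) simp_all
    finally show ?thesis .
  qed
  moreover have "(\<lambda>n. ennreal ((1/2) ^ n)) \<longlonglongrightarrow> ennreal 0"
    by (intro tendsto_ennrealI LIMSEQ_power_zero) simp
  ultimately have "emeasure ?M {b} \<le> ennreal 0"
    by (intro tendsto_lowerbound[where F = sequentially]) (auto intro: always_eventually)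
  then show ?thesis by simp
qed

text \<open>As a Souslin set, \<open>A\<close> is the projection of a closed set, so the Cantor
  scheme applies to \<open>fst\<close>. The coin-tossing measure is pushed forward along the
  resulting map; injectivity of that map prevents atoms.\<close>

lemma atomless_prob_on_uncountable_borel:
  fixes A :: "'a::polish_space set"
  assumes A: "A \<in> sets borel" and unc: "uncountable A"
  obtains \<nu> where "prob_space \<nu>" "sets \<nu> = sets borel" "AE x in \<nu>. x \<in> A" "\<And>x. emeasure \<nu> {x} = 0"
proof -
  obtain C :: "('a \<times> (nat \<Rightarrow> nat discrete)) set" where C: "closed C" "fst ` C = A"
    using souslin_borel[OF A] unfolding souslin_def by blast
  obtain h :: "(nat \<Rightarrow> bool) \<Rightarrow> 'a"
    where h: "h \<in> borel_measurable (PiM UNIV (\<lambda>_. count_space UNIV))" "inj h" "range h \<subseteq> A"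
    using cantor_scheme[OF C(1) continuous_on_fst[OF continuous_on_id]] unc C(2) by metis
  let ?M = "PiM UNIV (\<lambda>_. measure_pmf (bernoulli_pmf (1/2))) :: (nat \<Rightarrow> bool) measure"
  have "sets ?M = sets (PiM UNIV (\<lambda>_. count_space UNIV))"
    by (intro sets_PiM_cong) auto
  then have hm: "h \<in> borel_measurable ?M"
    using h(1) measurable_cong_sets by blast
  interpret M: prob_space ?M by (intro prob_space_PiM) unfold_locales
  show ?thesis
  proof
    show "prob_space (distr ?M borel h)" by (rule M.prob_space_distr[OF hm])
    show "AE x in distr ?M borel h. x \<in> A"
      using A h(3) by (subst AE_distr_iff[OF hm]) (auto simp: range_subsetD)
    show "emeasure (distr ?M borel h) {x} = 0" for x
    proof -
      have "emeasure (distr ?M borel h) {x} = emeasure ?M (h -` {x} \<inter> space ?M)"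
        by (rule emeasure_distr[OF hm]) simp
      also have "\<dots> = 0"
      proof (cases "x \<in> range h")
        case True
        then obtain b where "x = h b" by blast
        then have "h -` {x} \<inter> space ?M = {b}"
          using h(2) by (auto simp: space_PiM dest: injD)
        then show ?thesis by (simp add: coin_space_atomless)
      next
        case False
        then have "h -` {x} = {}" by auto
        then show ?thesis by simp
      qed
      finally show ?thesis .
    qed
  qed simp
qed

section \<open>Points of positive oscillation\<close>

text \<open>Connects \<open>osc\<close> with the continuity in the definition of \<open>CD\<close>:
  the diameter of an image bounds distances to \<open>g x\<close>, and is at most twice any bound on
  these distances.\<close>

lemma osc_eq_0_iff:
  fixes g :: "'a::metric_space \<Rightarrow> real"
  assumes "x \<in> X"
  shows "osc X g x = 0 \<longleftrightarrow> continuous (at x within X) g"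
proof
  assume osc: "osc X g x = 0"
  show "continuous (at x within X) g"
    unfolding continuous_within_eps_delta
  proof (intro allI impI)
    fix e :: real assume "0 < e"
    then have "osc X g x < ennreal e" using osc by simp
    then obtain U where U: "openin (top_of_set X) U" "x \<in> U" "ediameter (g ` U) < ennreal e"
      unfolding osc_def INF_less_iff by blast
    then obtain d where d: "d > 0" "\<And>y. y \<in> X \<Longrightarrow> dist y x < d \<Longrightarrow> y \<in> U"
      unfolding openin_euclidean_subtopology_iff by blast
    have "dist (g y) (g x) < e" if "y \<in> U" for y
    proof -
      have "ennreal (dist (g y) (g x)) \<le> ediameter (g ` U)"
        unfolding ediameter_def using that U(2) by (intro SUP_upper2[of "(g y, g x)"]) auto
      then have "ennreal (dist (g y) (g x)) < ennreal e" using U(3) by (rule le_less_trans)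
      then show ?thesis by (simp add: ennreal_less_iff)
    qed
    then show "\<exists>d>0. \<forall>y\<in>X. dist y x < d \<longrightarrow> dist (g y) (g x) < e" using d by blast
  qed
next
  assume cont: "continuous (at x within X) g"
  have le: "osc X g x \<le> ennreal e" if e: "e > 0" for e
  proof -
    obtain d where d: "d > 0" "\<And>y. y \<in> X \<Longrightarrow> dist y x < d \<Longrightarrow> dist (g y) (g x) < e / 2"
      using cont half_gt_zero[OF e] unfolding continuous_within_eps_delta by blast
    have "osc X g x \<le> ediameter (g ` (X \<inter> ball x d))"
      unfolding osc_def using assms d(1) by (intro INF_lower) (auto simp: openin_open_Int)
    also have "\<dots> \<le> ennreal e"
      unfolding ediameter_def
    proof (rule SUP_least, clarify)
      fix y z assume "y \<in> X" "y \<in> ball x d" "z \<in> X" "z \<in> ball x d"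
      then have "dist (g y) (g x) < e / 2" "dist (g z) (g x) < e / 2"
        using d(2)[of y] d(2)[of z] by (simp_all add: dist_commute)
      then have "dist (g y) (g z) < e" using dist_triangle2[of "g y" "g z" "g x"] by simp
      then show "ennreal (dist (g y) (g z)) \<le> ennreal e" by (intro ennreal_leI) simp
    qed
    finally show ?thesis .
  qed
  have "osc X g x \<le> 0"
  proof (rule ennreal_le_epsilon)
    fix e :: real assume "0 < e"
    then show "osc X g x \<le> 0 + ennreal e" unfolding add_0 by (rule le)
  qed
  then show "osc X g x = 0" by simp
qed

text \<open>For a countable basis this expresses positive oscillation by countable quantifiers over
  conditions that are open in g, the form needed for measurability.\<close>

lemma osc_pos_iff_basis:
  fixes X :: "'a::metric_space set"
  assumes B: "topological_basis \<B>" and x: "x \<in> X"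
  shows "osc X g x > 0 \<longleftrightarrow>
    (\<exists>n. \<forall>V\<in>\<B>. x \<in> V \<longrightarrow> (\<exists>a\<in>X \<inter> V. \<exists>b\<in>X \<inter> V. 1 / real (Suc n) < \<bar>g a - g b\<bar>))"
    (is "_ \<longleftrightarrow> (\<exists>n. ?R n)")
proof
  assume "osc X g x > 0"
  then have "\<not> continuous (at x within X) g" unfolding osc_eq_0_iff[OF x, symmetric] by simp
  then obtain e where e: "e > 0" "\<And>d. d > 0 \<Longrightarrow> \<exists>y\<in>X. dist y x < d \<and> e \<le> dist (g y) (g x)"
    unfolding continuous_within_eps_delta by (meson not_le)
  obtain n where n: "1 / real (Suc n) < e" using nat_approx_posE[OF e(1)] by metis
  have "?R n"
  proof (intro ballI impI)
    fix V assume V: "V \<in> \<B>" "x \<in> V"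
    then have "open V" using B topological_basis_open by blast
    then obtain d where d: "d > 0" "ball x d \<subseteq> V" using V(2) open_contains_ball by blast
    obtain y where "y \<in> X" "dist y x < d" "e \<le> dist (g y) (g x)" using e(2)[OF d(1)] by blast
    then show "\<exists>a\<in>X \<inter> V. \<exists>b\<in>X \<inter> V. 1 / real (Suc n) < \<bar>g a - g b\<bar>"
      using n d(2) V(2) x by (intro bexI[of _ y] bexI[of _ x]) (auto simp: dist_real_def dist_commute)
  qed
  then show "\<exists>n. ?R n" ..
next
  assume "\<exists>n. ?R n"
  then obtain n where n: "?R n" ..
  show "osc X g x > 0"
  proof (rule ccontr)
    assume "\<not> osc X g x > 0"
    then have "continuous (at x within X) g" unfolding osc_eq_0_iff[OF x, symmetric] by simp
    \<comment> \<open>Half the gap: two values within \<open>e\<close> of \<open>g x\<close> differ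
      by less than \<open>1 / real (Suc n)\<close>.\<close>
    moreover define e where "e = 1 / real (Suc n) / 2"
    moreover have "e > 0" by (simp add: e_def)
    ultimately obtain d where d: "d > 0" "\<And>y. y \<in> X \<Longrightarrow> dist y x < d \<Longrightarrow> dist (g y) (g x) < e"
      unfolding continuous_within_eps_delta by meson
    obtain V where V: "V \<in> \<B>" "x \<in> V" "V \<subseteq> ball x d"
      using topological_basisE[OF B, of "ball x d" x] d(1) by auto
    obtain a b where ab: "a \<in> X \<inter> V" "b \<in> X \<inter> V" "1 / real (Suc n) < \<bar>g a - g b\<bar>"
      using n V by blast
    have "dist (g a) (g x) < e" "dist (g b) (g x) < e"
      using ab V(3) by (auto intro!: d(2) simp: dist_commute)
    then have "\<bar>g a - g b\<bar> < e + e" by (simp add: dist_real_def abs_if split: if_splits)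
    also have "e + e = 1 / real (Suc n)" unfolding e_def by (rule field_sum_of_halves)
    finally show False using ab(3) by simp
  qed
qed

section \<open>Borel structure of \<open>K\<close> and the Fubini argument\<close>

lemma topspace_subtopology_CD:
  "K \<subseteq> CD X \<Longrightarrow> topspace (subtopology (CD_topology X) K) = K"
  by (auto simp: CD_topology_def CD_def)

lemma openin_sets_borel_of: "openin T U \<Longrightarrow> U \<in> sets (borel_of T)"
proof -
  have "{U. openin T U} \<subseteq> Pow (topspace T)" using openin_subset by blast
  then show "openin T U \<Longrightarrow> U \<in> sets (borel_of T)" by (simp add: borel_of_def sigma_sets.Basic)
qed

lemma space_borel_of: "space (borel_of T) = topspace T"
  by (simp add: borel_of_def space_measure_of_conv)

lemma closedin_sets_borel_of:
  assumes "closedin T C" shows "C \<in> sets (borel_of T)"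
proof -
  have "topspace T - (topspace T - C) \<in> sets (borel_of T)"
    using assms openin_sets_borel_of[of T "topspace T - C"] sets.compl_sets[of _ "borel_of T"]
    by (auto simp: space_borel_of)
  then show ?thesis using closedin_subset[OF assms] by (simp add: double_diff)
qed

lemma continuous_map_eval:
  assumes "a \<in> X"
  shows "continuous_map (subtopology (CD_topology X) K) euclideanreal (\<lambda>g. g a)"
  unfolding CD_topology_def
  by (intro continuous_map_from_subtopology continuous_map_product_projection assms)

text \<open>The oscillation is jointly measurable because it is described by countably many
  rectangles \<open>G \<times> V\<close>, with \<open>G\<close> open in \<open>K\<close> and \<open>V\<close> basic open.\<close>

lemma osc_pos_measurable_pair:
  fixes X :: "'a::{metric_space, second_countable_topology} set"
  assumes K: "K \<subseteq> CD X" and X: "X \<in> sets borel"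
    and \<mu>: "sets \<mu> = sets (borel_of (subtopology (CD_topology X) K))" and \<nu>: "sets \<nu> = sets borel"
  shows "{(g, x). g \<in> K \<and> x \<in> X \<and> osc X g x > 0} \<in> sets (\<mu> \<Otimes>\<^sub>M \<nu>)"
proof -
  let ?T = "subtopology (CD_topology X) K"
  have top: "topspace ?T = K" by (rule topspace_subtopology_CD[OF K])
  obtain \<B> :: "'a set set" where B: "countable \<B>" "topological_basis \<B>"
    using ex_countable_basis by blast
  define G where "G V n = {g \<in> K. \<exists>a\<in>X \<inter> V. \<exists>b\<in>X \<inter> V. 1 / real (Suc n) < \<bar>g a - g b\<bar>}" for V n
  have G: "G V n \<in> sets \<mu>" for V n
  proof -
    have "openin ?T {g \<in> topspace ?T. \<bar>g a - g b\<bar> \<in> {1 / real (Suc n)<..}}"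
      if "a \<in> X" "b \<in> X" for a b
      by (rule openin_continuous_map_preimage[where Y = euclideanreal])
        (auto intro!: continuous_intros continuous_map_eval that)
    \<comment> \<open>The union may be uncountable; its measurability comes from openness.\<close>
    then have "openin ?T (\<Union>a\<in>X \<inter> V. \<Union>b\<in>X \<inter> V. {g \<in> K. 1 / real (Suc n) < \<bar>g a - g b\<bar>})"
      unfolding top by (intro openin_Union) (auto simp del: Union_iff)
    also have "(\<Union>a\<in>X \<inter> V. \<Union>b\<in>X \<inter> V. {g \<in> K. 1 / real (Suc n) < \<bar>g a - g b\<bar>}) = G V n"
      by (auto simp: G_def)
    finally show ?thesis unfolding \<mu> by (rule openin_sets_borel_of)
  qed
  have Kmem: "K \<in> sets \<mu>" unfolding \<mu> using openin_sets_borel_of[of ?T K] top openin_topspace[of ?T] by simp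
  \<comment> \<open>The implication from \<open>x \<in> V\<close> to \<open>g \<in> G V n\<close>
    becomes a union of two rectangles.\<close>
  have "{(g, x). g \<in> K \<and> x \<in> X \<and> osc X g x > 0} =
    (K \<times> X) \<inter> (\<Union>n. \<Inter>V\<in>\<B>. G V n \<times> X \<union> K \<times> (X - V))"
  proof (rule set_eqI, clarify)
    fix g x
    show "(g, x) \<in> {(g, x). g \<in> K \<and> x \<in> X \<and> osc X g x > 0} \<longleftrightarrow>
      (g, x) \<in> (K \<times> X) \<inter> (\<Union>n. \<Inter>V\<in>\<B>. G V n \<times> X \<union> K \<times> (X - V))"
    proof (cases "g \<in> K \<and> x \<in> X")
      case True
      then have "osc X g x > 0 \<longleftrightarrow> (\<exists>n. \<forall>V\<in>\<B>. x \<in> V \<longrightarrow> g \<in> G V n)"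
        using osc_pos_iff_basis[OF B(2), of x X g] by (simp add: G_def)
      with True show ?thesis by blast
    qed blast
  qed
  also have "\<dots> \<in> sets (\<mu> \<Otimes>\<^sub>M \<nu>)"
  proof -
    have "V \<in> sets borel" if "V \<in> \<B>" for V using that B(2) by (simp add: topological_basis_open)
    then have "G V n \<times> X \<union> K \<times> (X - V) \<in> sets (\<mu> \<Otimes>\<^sub>M \<nu>)" if "V \<in> \<B>" for V n
      using that X G Kmem \<nu> by (intro sets.Un pair_measureI) auto
    moreover have "\<B> \<noteq> {}" using topological_basisE[OF B(2) open_UNIV, of undefined] by auto
    ultimately have "(\<Inter>V\<in>\<B>. G V n \<times> X \<union> K \<times> (X - V)) \<in> sets (\<mu> \<Otimes>\<^sub>M \<nu>)" for n
      using B(1) by (intro sets.countable_INT') auto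
    moreover have "K \<times> X \<in> sets (\<mu> \<Otimes>\<^sub>M \<nu>)"
      using X Kmem \<nu> by (intro pair_measureI) auto
    ultimately show ?thesis by (intro sets.Int sets.countable_UN) auto
  qed
  finally show ?thesis .
qed

lemma countable_osc_pos:
  fixes X :: "'a::polish_space set"
  assumes K: "K \<subseteq> CD X" and X: "X \<in> sets borel"
    and \<mu>: "sets \<mu> = sets (borel_of (subtopology (CD_topology X) K))" "prob_space \<mu>"
  shows "countable {x \<in> X. emeasure \<mu> {g \<in> K. osc X g x > 0} > 0}" (is "countable ?E")
proof (rule ccontr)
  define W where "W = {(g, x). g \<in> K \<and> x \<in> X \<and> osc X g x > 0}"
  interpret \<mu>: prob_space \<mu> by fact
  assume unc: "uncountable ?E"
  have sect: "(\<lambda>g. (g, x)) -` W = (if x \<in> X then {g \<in> K. osc X g x > 0} else {})" for x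
    by (auto simp: W_def)
  have W: "W \<in> sets (\<mu> \<Otimes>\<^sub>M \<nu>)" if "sets \<nu> = sets borel" for \<nu> :: "'a measure"
    unfolding W_def by (rule osc_pos_measurable_pair[OF K X \<mu>(1) that])
  \<comment> \<open>A point mass stands in for the measure on the second factor: measurability of
    the section function depends only on the sigma-algebra, and \<open>\<nu>\<close> can be chosen
    only once \<open>?E\<close> is known to be Borel.\<close>
  interpret borel_pair: pair_sigma_finite \<mu> "return borel (undefined::'a)"
    by (intro pair_sigma_finite.intro \<mu>.sigma_finite_measure_axioms
        prob_space_imp_sigma_finite prob_space_return) simp
  have "(\<lambda>x. emeasure \<mu> ((\<lambda>g. (g, x)) -` W)) \<in> borel_measurable (return borel (undefined::'a))"
    by (rule borel_pair.measurable_emeasure_Pair2) (rule W, simp)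
  then have "(\<lambda>x. emeasure \<mu> ((\<lambda>g. (g, x)) -` W)) \<in> borel_measurable borel" by simp
  then have "{x \<in> space borel. 0 < emeasure \<mu> ((\<lambda>g. (g, x)) -` W)} \<in> sets borel" by measurable
  also have "{x \<in> space borel. 0 < emeasure \<mu> ((\<lambda>g. (g, x)) -` W)} = ?E" by (auto simp: sect)
  finally obtain \<nu> where \<nu>: "prob_space \<nu>" "sets \<nu> = sets borel" "AE x in \<nu>. x \<in> ?E"
      "\<And>x. emeasure \<nu> {x} = 0"
    using atomless_prob_on_uncountable_borel unc by blast
  interpret \<nu>: prob_space \<nu> by fact
  interpret pair_sigma_finite \<mu> \<nu> ..
  \<comment> \<open>For fixed g the section consists of discontinuities of g, a countable set, hence
    null for the atomless \<open>\<nu>\<close>.\<close>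
  have "emeasure \<nu> (Pair g -` W) = 0" for g
  proof (cases "g \<in> K")
    case True
    then have "Pair g -` W = {x \<in> X. \<not> continuous (at x within X) g}"
      using osc_eq_0_iff by (auto simp: W_def zero_less_iff_neq_zero)
    moreover have "countable {x \<in> X. \<not> continuous (at x within X) g}"
      using K True by (auto simp: CD_def)
    ultimately have "countable (Pair g -` W)" by simp
    moreover have "{x} \<in> null_sets \<nu>" for x using \<nu>(2,4) by (intro null_setsI) auto
    ultimately have "(\<Union>x\<in>Pair g -` W. {x}) \<in> null_sets \<nu>" by (intro null_sets_UN')
    then show ?thesis by auto
  qed (auto simp: W_def)
  then have "emeasure (\<mu> \<Otimes>\<^sub>M \<nu>) W = 0"
    by (subst \<nu>.emeasure_pair_measure_alt[OF W[OF \<nu>(2)]]) simp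
  \<comment> \<open>In the other order of integration the sections have positive measure for almost
    every x, since \<open>\<nu>\<close> is concentrated on \<open>?E\<close>.\<close>
  then have "(\<integral>\<^sup>+x. emeasure \<mu> ((\<lambda>g. (g, x)) -` W) \<partial>\<nu>) = 0"
    by (subst (asm) emeasure_pair_measure_alt2[OF W[OF \<nu>(2)]])
  then have "AE x in \<nu>. emeasure \<mu> ((\<lambda>g. (g, x)) -` W) = 0"
    using nn_integral_0_iff_AE[OF measurable_emeasure_Pair2[OF W[OF \<nu>(2)]]] by simp
  with \<nu>(3) have "AE x in \<nu>. False"
    by eventually_elim (auto simp: sect)
  then show False using \<nu>.AE_False by simp
qed

section \<open>Countable determination\<close>

lemma openin_CD_contains_basic:
  assumes K: "K \<subseteq> CD X" and U: "openin (subtopology (CD_topology X) K) U" and g: "g \<in> U"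
  shows "\<exists>J e. finite J \<and> J \<subseteq> X \<and> 0 < e \<and> {h \<in> K. \<forall>x\<in>J. dist (h x) (g x) < e} \<subseteq> U"
proof -
  have "subtopology (CD_topology X) K = subtopology (product_topology (\<lambda>_. euclideanreal) X) K"
    using K by (simp add: CD_topology_def subtopology_subtopology inf.absorb2)
  then obtain U0 where U0: "openin (product_topology (\<lambda>_. euclideanreal) X) U0" "U = U0 \<inter> K"
    using U by (auto simp: openin_subtopology)
  then obtain W where W: "finite {x \<in> X. W x \<noteq> UNIV}" "\<And>x. x \<in> X \<Longrightarrow> open (W x)"
      "g \<in> PiE X W" "PiE X W \<subseteq> U0"
    using g unfolding openin_product_topology_alt by fastforce
  define J where "J = {x \<in> X. W x \<noteq> UNIV}"
  have "\<exists>e>0. ball (g x) e \<subseteq> W x" if "x \<in> X" for x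
    using W(2,3) that open_contains_ball by blast
  then obtain r where r: "\<And>x. x \<in> X \<Longrightarrow> 0 < r x" "\<And>x. x \<in> X \<Longrightarrow> ball (g x) (r x) \<subseteq> W x"
    by metis
  \<comment> \<open>The extra 1 keeps the minimum meaningful when \<open>J\<close> is empty.\<close>
  define e where "e = Min (insert 1 (r ` J))"
  have J: "finite J" "J \<subseteq> X" using W(1) by (auto simp: J_def)
  show ?thesis
  proof (intro exI conjI)
    show "0 < e" using J r(1) by (auto simp: e_def)
    show "{h \<in> K. \<forall>x\<in>J. dist (h x) (g x) < e} \<subseteq> U"
    proof clarify
      fix h assume h: "h \<in> K" "\<forall>x\<in>J. dist (h x) (g x) < e"
      have "h x \<in> W x" if x: "x \<in> X" for x
      proof (cases "x \<in> J")
        case True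
        then have "e \<le> r x" using J(1) by (simp add: e_def)
        then have "h x \<in> ball (g x) (r x)" using h(2) True by (force simp: dist_commute)
        then show ?thesis using r(2)[OF x] by blast
      qed (use x in \<open>simp add: J_def\<close>)
      \<comment> \<open>Membership in \<open>PiE X W\<close> also prescribes the value off
        \<open>X\<close>.\<close>
      moreover have "h \<in> extensional X" using h(1) K by (auto simp: CD_def PiE_def)
      ultimately have "h \<in> PiE X W" by (auto simp: PiE_def)
      then show "h \<in> U" using W(4) U0(2) h(1) by blast
    qed
  qed (use J in auto)
qed

lemma openin_CD_basic:
  assumes K: "K \<subseteq> CD X" and J: "finite J" "J \<subseteq> X"
  shows "openin (subtopology (CD_topology X) K) {h \<in> K. \<forall>x\<in>J. dist (h x) (g x) < e}"
proof -
  let ?T = "subtopology (CD_topology X) K"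
  have "openin ?T {h \<in> topspace ?T. h x \<in> ball (g x) e}" if "x \<in> J" for x
    by (rule openin_continuous_map_preimage[OF continuous_map_eval]) (use that J in auto)
  \<comment> \<open>Inserting the whole space makes the intersection equal to \<open>K\<close> when
    \<open>J\<close> is empty.\<close>
  then have "openin ?T (\<Inter> (insert (topspace ?T) ((\<lambda>x. {h \<in> topspace ?T. h x \<in> ball (g x) e}) ` J)))"
    using J(1) by (intro openin_Inter) (auto simp del: topspace_subtopology)
  also have "\<Inter> (insert (topspace ?T) ((\<lambda>x. {h \<in> topspace ?T. h x \<in> ball (g x) e}) ` J)) =
      {h \<in> K. \<forall>x\<in>J. dist (h x) (g x) < e}"
    using topspace_subtopology_CD[OF K] by (auto simp: dist_commute)
  finally show ?thesis .
qed

text \<open>\<open>Y\<close> may be infinite: every point imposes a closed condition, and arbitrary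
  intersections of closed sets are closed.\<close>

lemma closedin_CD_band:
  assumes K: "K \<subseteq> CD X" and Y: "Y \<subseteq> X"
  shows "closedin (subtopology (CD_topology X) K) {h \<in> K. \<forall>y\<in>Y. h y \<in> {p..q}}"
proof -
  let ?T = "subtopology (CD_topology X) K"
  have "closedin ?T {h \<in> topspace ?T. h y \<in> {p..q}}" if "y \<in> Y" for y
    by (rule closedin_continuous_map_preimage[OF continuous_map_eval]) (use that Y in auto)
  then have "closedin ?T (\<Inter> (insert (topspace ?T) ((\<lambda>y. {h \<in> topspace ?T. h y \<in> {p..q}}) ` Y)))"
    by (intro closedin_Inter) (auto simp del: topspace_subtopology)
  also have "\<Inter> (insert (topspace ?T) ((\<lambda>y. {h \<in> topspace ?T. h y \<in> {p..q}}) ` Y)) =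
      {h \<in> K. \<forall>y\<in>Y. h y \<in> {p..q}}"
    using topspace_subtopology_CD[OF K] by auto
  finally show ?thesis .
qed

text \<open>Continuity from below along the initial segments of an enumeration; it reduces countable
  unions to finite ones.\<close>

lemma emeasure_Union_countable_le:
  assumes "countable \<A>" "\<A> \<subseteq> sets \<mu>"
    and le: "\<And>\<J>. finite \<J> \<Longrightarrow> \<J> \<subseteq> \<A> \<Longrightarrow> emeasure \<mu> (\<Union>\<J>) \<le> c"
  shows "emeasure \<mu> (\<Union>\<A>) \<le> c"
proof (cases "\<A> = {}")
  case False
  define A where "A n = \<Union> (from_nat_into \<A> ` {..n})" for n
  have mem: "from_nat_into \<A> n \<in> \<A>" for n by (rule from_nat_into[OF False])
  have "(\<Union>n. A n) = \<Union>\<A>"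
    using range_from_nat_into[OF False assms(1)] by (auto simp: A_def) blast+
  moreover have "(SUP n. emeasure \<mu> (A n)) = emeasure \<mu> (\<Union>n. A n)"
  proof (rule SUP_emeasure_incseq)
    show "range A \<subseteq> sets \<mu>" using mem assms(2) by (auto simp: A_def)
    show "incseq A" unfolding A_def incseq_def by (intro allI impI Union_mono image_mono) auto
  qed
  moreover have "emeasure \<mu> (A n) \<le> c" for n
    unfolding A_def by (rule le) (use mem in auto)
  ultimately show ?thesis by (metis SUP_least)
qed (use le[of "{}"] in simp)

lemma countably_determined_if_osc_null:
  fixes X :: "'a::{metric_space, second_countable_topology} set"
  assumes K: "K \<subseteq> CD X" and \<mu>: "\<mu> \<in> radon_prob_measures (subtopology (CD_topology X) K)"
    and E: "countable E" "E \<subseteq> X"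
    and null: "\<And>x. x \<in> X - E \<Longrightarrow> emeasure \<mu> {g \<in> K. osc X g x > 0} = 0"
  shows "countably_determined (subtopology (CD_topology X) K) \<mu>"
proof -
  let ?T = "subtopology (CD_topology X) K"
  have top: "topspace ?T = K" by (rule topspace_subtopology_CD[OF K])
  have sets: "sets \<mu> = sets (borel_of ?T)"
    and radon: "\<And>A. A \<in> sets \<mu> \<Longrightarrow> emeasure \<mu> A = (SUP C \<in> {C. compactin ?T C \<and> C \<subseteq> A}. emeasure \<mu> C)"
    using \<mu> unfolding radon_prob_measures_def by blast+
  obtain \<B> :: "'a set set" where B: "countable \<B>" "topological_basis \<B>"
    using ex_countable_basis by blast
  \<comment> \<open>Basic sets serve the points where almost every function is continuous; the
    countably many exceptional points get singletons.\<close>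
  define \<Y> where "\<Y> = (\<lambda>V. X \<inter> V) ` \<B> \<union> (\<lambda>x. {x}) ` E"
  define S where "S Y p q = {h \<in> K. \<forall>y\<in>Y. h y \<in> {p..q}}" for Y and p q :: real
  define \<S> where "\<S> = (\<lambda>(Y, p, q). S Y p q) ` (\<Y> \<times> \<rat> \<times> \<rat>)"
  define \<G> where "\<G> = (\<lambda>I. K \<inter> \<Inter>I) ` {I. finite I \<and> I \<subseteq> \<S>}"
  define \<F> where "\<F> = Union ` {J. finite J \<and> J \<subseteq> \<G>}"
  have countable: "countable \<S>" "countable \<G>" "countable \<F>"
  proof -
    show "countable \<S>" unfolding \<S>_def \<Y>_def
      by (intro countable_image countable_SIGMA countable_Un B(1) E(1) countable_rat)
    then show "countable \<G>" unfolding \<G>_def by (intro countable_image countable_Collect_finite_subset)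
    then show "countable \<F>" unfolding \<F>_def by (intro countable_image countable_Collect_finite_subset)
  qed
  have closed_\<S>: "closedin ?T A" if A: "A \<in> \<S>" for A
  proof -
    obtain Y p q where "Y \<in> \<Y>" "A = S Y p q" using A by (auto simp: \<S>_def)
    moreover from this have "Y \<subseteq> X" using E(2) by (auto simp: \<Y>_def)
    ultimately show ?thesis unfolding S_def using closedin_CD_band[OF K] by simp
  qed
  have closed_\<G>: "closedin ?T A" if A: "A \<in> \<G>" for A
  proof -
    obtain I where I: "finite I" "I \<subseteq> \<S>" "A = K \<inter> \<Inter>I" using A by (auto simp: \<G>_def)
    have "closedin ?T (\<Inter>(insert K I))"
      using I(2) closed_\<S> closedin_topspace[of ?T] unfolding top by (intro closedin_Inter) auto
    then show ?thesis using I(3) by simp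
  qed
  have closed_\<F>: "closedin ?T A" if "A \<in> \<F>" for A
    using that closed_\<G> by (auto simp: \<F>_def intro!: closedin_Union)
  \<comment> \<open>\<open>\<G>\<close> acts as a countable network up to null sets: only functions
    discontinuous at some point of \<open>J - E\<close> may escape.\<close>
  have \<G>_nbhd: "\<exists>G\<in>\<G>. h \<in> G \<and> (\<forall>k\<in>G. \<forall>x\<in>J. dist (k x) (g x) < e)"
    if h: "h \<in> K" "\<forall>x\<in>J. dist (h x) (g x) < e" and J: "finite J" "J \<subseteq> X"
      and osc: "\<And>x. x \<in> J - E \<Longrightarrow> osc X h x = 0" for h g J e
  proof -
    have "\<exists>A\<in>\<S>. h \<in> A \<and> (\<forall>k\<in>A. dist (k x) (g x) < e)" if x: "x \<in> J" for x
    proof -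
      \<comment> \<open>The slack at x: on \<open>Y\<close> the values of h stay within
        \<open>d / 2\<close> of \<open>h x\<close>, and rational endpoints at distance between
        \<open>d / 2\<close> and \<open>d\<close> give a band that contains them and keeps
        \<open>k x\<close> within \<open>e\<close> of \<open>g x\<close>.\<close>
      define d where "d = e - dist (h x) (g x)"
      have d: "d > 0" using h(2) x by (simp add: d_def)
      have "\<exists>Y\<in>\<Y>. x \<in> Y \<and> (\<forall>y\<in>Y. dist (h y) (h x) < d / 2)"
      proof (cases "x \<in> E")
        case True
        then show ?thesis using d by (intro bexI[of _ "{x}"]) (auto simp: \<Y>_def)
      next
        case False
        then have "continuous (at x within X) h"
          using osc_eq_0_iff[of x X h] osc x J by blast
        then obtain r where r: "r > 0" "\<And>y. y \<in> X \<Longrightarrow> dist y x < r \<Longrightarrow> dist (h y) (h x) < d / 2"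
          using half_gt_zero[OF d] unfolding continuous_within_eps_delta by blast
        obtain V where "V \<in> \<B>" "x \<in> V" "V \<subseteq> ball x r"
          using topological_basisE[OF B(2), of "ball x r" x] r(1) by auto
        then show ?thesis
          using x J r(2) by (intro bexI[of _ "X \<inter> V"]) (auto simp: \<Y>_def dist_commute subset_iff)
      qed
      then obtain Y where Y: "Y \<in> \<Y>" "x \<in> Y" "\<And>y. y \<in> Y \<Longrightarrow> dist (h y) (h x) < d / 2" by blast
      obtain p where p: "p \<in> \<rat>" "h x - d < p" "p < h x - d / 2"
        using Rats_dense_in_real[of "h x - d" "h x - d / 2"] d by auto
      obtain q where q: "q \<in> \<rat>" "h x + d / 2 < q" "q < h x + d"
        using Rats_dense_in_real[of "h x + d / 2" "h x + d"] d by auto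
      have "h y \<in> {p..q}" if "y \<in> Y" for y
        using Y(3)[OF that] p q by (simp add: dist_real_def abs_if split: if_splits)
      then have "h \<in> S Y p q" using h(1) by (simp add: S_def)
      moreover have "S Y p q \<in> \<S>" using Y(1) p(1) q(1) by (force simp: \<S>_def)
      moreover have "dist (k x) (g x) < e" if "k \<in> S Y p q" for k
      proof -
        have "p \<le> k x" "k x \<le> q" using that Y(2) by (auto simp: S_def)
        then have "dist (k x) (h x) < d" using p q by (simp add: dist_real_def abs_if)
        then show ?thesis using dist_triangle[of "k x" "g x" "h x"] by (simp add: d_def)
      qed
      ultimately show ?thesis by blast
    qed
    then obtain A where A: "\<And>x. x \<in> J \<Longrightarrow> A x \<in> \<S>" "\<And>x. x \<in> J \<Longrightarrow> h \<in> A x"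
        "\<And>x k. x \<in> J \<Longrightarrow> k \<in> A x \<Longrightarrow> dist (k x) (g x) < e"
      by metis
    have "K \<inter> \<Inter>(A ` J) \<in> \<G>"
      unfolding \<G>_def using J(1) A(1) by (intro imageI) auto
    then show ?thesis using h(1) A(2,3) by (intro bexI[of _ "K \<inter> \<Inter>(A ` J)"]) auto
  qed
  have "emeasure \<mu> U = (SUP F \<in> {F \<in> \<F>. F \<subseteq> U}. emeasure \<mu> F)" if U: "openin ?T U" for U
  proof (rule antisym)
    have Usets: "U \<in> sets \<mu>" using U openin_sets_borel_of sets by blast
    then show "(SUP F \<in> {F \<in> \<F>. F \<subseteq> U}. emeasure \<mu> F) \<le> emeasure \<mu> U"
      by (intro SUP_least emeasure_mono) auto
    \<comment> \<open>By inner regularity it suffices that \<open>H\<close> contains every compact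
      subset of \<open>U\<close> up to a null set.\<close>
    define H where "H = \<Union>{G \<in> \<G>. G \<subseteq> U}"
    have \<G>sets: "{G \<in> \<G>. G \<subseteq> U} \<subseteq> sets \<mu>"
      using closed_\<G> closedin_sets_borel_of sets by blast
    have cnt: "countable {G \<in> \<G>. G \<subseteq> U}" using countable(2) by (rule countable_subset[rotated]) auto
    have Hsets: "H \<in> sets \<mu>" unfolding H_def using cnt \<G>sets by (rule sets.countable_Union)
    have "emeasure \<mu> C \<le> emeasure \<mu> H" if C: "compactin ?T C" "C \<subseteq> U" for C
    proof -
      define basic where "basic g J e \<longleftrightarrow> finite J \<and> J \<subseteq> X \<and> 0 < e \<and>
        {h \<in> K. \<forall>x\<in>J. dist (h x) (g x) < e} \<subseteq> U" for g J e
      have "\<exists>J e. basic g J e" if "g \<in> C" for g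
        unfolding basic_def by (rule openin_CD_contains_basic[OF K U]) (use that C(2) in blast)
      then obtain J e where "\<And>g. g \<in> C \<Longrightarrow> basic g (J g) (e g)" by metis
      then have Je: "\<And>g. g \<in> C \<Longrightarrow> finite (J g)" "\<And>g. g \<in> C \<Longrightarrow> J g \<subseteq> X"
          "\<And>g. g \<in> C \<Longrightarrow> 0 < e g"
          "\<And>g. g \<in> C \<Longrightarrow> {h \<in> K. \<forall>x\<in>J g. dist (h x) (g x) < e g} \<subseteq> U"
        unfolding basic_def by simp_all
      define N where "N g = {h \<in> K. \<forall>x\<in>J g. dist (h x) (g x) < e g}" for g
      have CK: "C \<subseteq> K" using compactin_subset_topspace[OF C(1)] top by simp
      have "\<forall>V\<in>N ` C. openin ?T V"
        using openin_CD_basic[OF K] Je(1,2) by (auto simp: N_def)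
      moreover have "C \<subseteq> \<Union>(N ` C)" using CK Je(3) by (force simp: N_def)
      ultimately obtain \<N> where "finite \<N>" "\<N> \<subseteq> N ` C" "C \<subseteq> \<Union>\<N>"
        using C(1)[unfolded compactin_def, THEN conjunct2, rule_format, of "N ` C"] by blast
      moreover from this obtain C0 where "C0 \<subseteq> C" "finite C0" "\<N> = N ` C0"
        using finite_subset_image by meson
      ultimately have C0: "C0 \<subseteq> C" "finite C0" "C \<subseteq> (\<Union>g\<in>C0. N g)" by auto
      \<comment> \<open>Compactness of \<open>C\<close> leaves finitely many coordinates, so the
        exceptional functions form a finite union of null sets.\<close>
      define Z where "Z = (\<Union>x\<in>(\<Union>g\<in>C0. J g) - E. {h \<in> K. osc X h x > 0})"
      have fin: "finite ((\<Union>g\<in>C0. J g) - E)" using C0 Je(1) by (intro finite_Diff finite_UN_I) auto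
      have "{h \<in> K. osc X h x > 0} \<in> null_sets \<mu>" if "x \<in> (\<Union>g\<in>C0. J g) - E" for x
      proof -
        have "x \<in> X - E" using that C0(1) Je(2) by blast
        then show ?thesis
          \<comment> \<open>Measure 0 alone does not make a null set, since \<open>emeasure\<close>
            is also 0 on non-measurable sets.\<close>
          using null sets_borel_of_osc_pos[OF K, of x] sets by (intro null_setsI) auto
      qed
      then have Z: "Z \<in> null_sets \<mu>"
        unfolding Z_def using fin by (intro null_sets_UN') (auto intro: countable_finite)
      have "C \<subseteq> H \<union> Z"
      proof
        fix h assume "h \<in> C"
        then obtain g where g: "g \<in> C0" "h \<in> N g" using C0(3) by blast
        show "h \<in> H \<union> Z"
        proof (cases "h \<in> Z")
          case False
          then have "osc X h x = 0" if "x \<in> J g - E" for x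
            using that g \<open>h \<in> C\<close> CK by (auto simp: Z_def)
          moreover have "h \<in> K" "\<forall>x\<in>J g. dist (h x) (g x) < e g" "finite (J g)" "J g \<subseteq> X"
            using g C0(1) Je(1,2) by (auto simp: N_def)
          ultimately obtain G where G: "G \<in> \<G>" "h \<in> G" "\<forall>k\<in>G. \<forall>x\<in>J g. dist (k x) (g x) < e g"
            using \<G>_nbhd[of h "J g" g "e g"] by blast
          have "G \<subseteq> K" using G(1) by (auto simp: \<G>_def)
          then have "G \<subseteq> U" using G(3) Je(4)[of g] g C0(1) by blast
          then show ?thesis using G by (auto simp: H_def)
        qed simp
      qed
      then have "emeasure \<mu> C \<le> emeasure \<mu> (H \<union> Z)"
        using Hsets Z by (intro emeasure_mono) auto
      also have "\<dots> = emeasure \<mu> H" by (rule emeasure_Un_null_set[OF Hsets Z])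
      finally show ?thesis .
    qed
    then have "emeasure \<mu> U \<le> emeasure \<mu> H"
      unfolding radon[OF Usets] by (intro SUP_least) auto
    also have "\<dots> \<le> (SUP F \<in> {F \<in> \<F>. F \<subseteq> U}. emeasure \<mu> F)"
      unfolding H_def
    proof (rule emeasure_Union_countable_le[OF cnt \<G>sets])
      fix \<J> assume "finite \<J>" "\<J> \<subseteq> {G \<in> \<G>. G \<subseteq> U}"
      then have "\<Union>\<J> \<in> {F \<in> \<F>. F \<subseteq> U}" unfolding \<F>_def by blast
      then show "emeasure \<mu> (\<Union>\<J>) \<le> (SUP F \<in> {F \<in> \<F>. F \<subseteq> U}. emeasure \<mu> F)" by (rule SUP_upper)
    qed
    finally show "emeasure \<mu> U \<le> (SUP F \<in> {F \<in> \<F>. F \<subseteq> U}. emeasure \<mu> F)" .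
  qed
  then show ?thesis
    unfolding countably_determined_def using countable(3) closed_\<F> by blast
qed

theorem theorem4p2:
  fixes X :: "'a::polish_space set" and K :: "('a \<Rightarrow> real) set"
  assumes "X \<in> sets borel"
    and "compactin (CD_topology X) K"
  shows "(\<forall>\<mu> \<in> radon_prob_measures (subtopology (CD_topology X) K).
            countable {x \<in> X. emeasure \<mu> {g \<in> K. osc X g x > 0} > 0}) \<and>
         (\<forall>\<mu> \<in> radon_prob_measures (subtopology (CD_topology X) K).
            countably_determined (subtopology (CD_topology X) K) \<mu>)"
proof -
  have "topspace (CD_topology X) = CD X" by (auto simp: CD_topology_def CD_def)
  then have K: "K \<subseteq> CD X" using compactin_subset_topspace[OF assms(2)] by simp
  have cnt: "countable {x \<in> X. emeasure \<mu> {g \<in> K. osc X g x > 0} > 0}"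
    if "\<mu> \<in> radon_prob_measures (subtopology (CD_topology X) K)" for \<mu>
    using that countable_osc_pos[OF K assms(1), of \<mu>] by (simp add: radon_prob_measures_def)
  then have "countably_determined (subtopology (CD_topology X) K) \<mu>"
    if "\<mu> \<in> radon_prob_measures (subtopology (CD_topology X) K)" for \<mu>
    \<comment> \<open>\<open>E\<close> is the countable set from the first part; off it the measure
      is not positive, hence 0.\<close>
    by (rule countably_determined_if_osc_null[OF K that]) (use that in \<open>auto simp: not_gr_zero\<close>)
  with cnt show ?thesis by blast
qed

end
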